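(* With respect to the Fermat pseudometric $d_{\mathrm F}(x,y):=|{}^\circ x-{}^\circ y|$, the ring ${}^\bullet\mathbb{R}$ is complete (every Cauchy sequence converges). In particular, if $(s_n)_n$ is a Cauchy sequence in ${}^\bullet\mathbb{R}$ with respect to $d_{\mathrm F}$, then $({}^\circ s_n)_n$ is a Cauchy sequence of $\mathbb{R}$; and if $r\in\mathbb{R}$ is its limit, then for every $x\in\mu(r):=\{x\in{}^\bullet\mathbb{R}\mid{}^\circ x=r\}$ the sequence $(s_n)_n$ converges to $x$ with respect to $d_{\mathrm F}$.
   Context: Fermat reals. A little-oh polynomial is a function $x:\mathbb{R}_{\ge0}\to\mathbb{R}$ such that $x(t)=r+\sum_{i=1}^N a_i t^{\alpha_i}+o(t)$ as $t\to0^+$, for some $N\in\mathbb{N}$, $r,a_i\in\mathbb{R}$, $\alpha_i\in\mathbb{R}_{\ge0}$. Put $x\sim y$ iff $x(t)=y(t)+o(t)$ as $t\to0^+$. The ring ${}^\bullet\mathbb{R}$ of Fermat reals is the quotient of the ring of little-oh polynomials (pointwise operations) by $\sim$; it contains $\mathbb{R}$ (classes of constants). For real $a>0$, $\mathrm{d}t_a$ denotes the class of $t\mapsto t^{1/a}$ (so $\mathrm{d}t_a=0$ iff $a<1$). Every $x\in{}^\bullet\mathbb{R}$ can be written uniquely as $x={}^\circ x+\sum_{i=1}^N\alpha_i\,\mathrm{d}t_{a_i}$ with ${}^\circ x,\alpha_i\in\mathbb{R}$, $\alpha_i\ne0$, $a_1>\dots>a_N\ge1$, $N\ge0$ (the decomposition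 of $x$). The real number ${}^\circ x$ is the standard part of $x$ (equivalently ${}^\circ x=\lim_{t\to0^+}x(t)$ for any representative). *)

theory Defs
  imports Complex_Main "HOL-Library.Landau_Symbols"
begin

section \<open>Little-oh polynomials\<close>

text \<open>
  Functions on the non-negative reals are represented by total functions on the reals. All notions
  below depend only on the germ of a function at \<open>0\<close> from the right, so the values at negative
  arguments play no role, and the quotient is the same. In particular \<open>t powr 0 = 1\<close> holds for
  all the \<open>t > 0\<close> that matter.
\<close>

definition little_oh_poly :: "(real \<Rightarrow> real) \<Rightarrow> bool" where
  "little_oh_poly x \<longleftrightarrow>
     (\<exists>(N::nat) (r::real) (a::nat \<Rightarrow> real) (\<alpha>::nat \<Rightarrow> real).
        (\<forall>i\<in>{1..N}. \<alpha> i \<ge> 0) \<and>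
        (\<lambda>t. x t - (r + (\<Sum>i=1..N. a i * t powr \<alpha> i))) \<in> o[at_right 0](\<lambda>t. t))"

definition fermat_equiv :: "(real \<Rightarrow> real) \<Rightarrow> (real \<Rightarrow> real) \<Rightarrow> bool" where
  "fermat_equiv x y \<longleftrightarrow> (\<lambda>t. x t - y t) \<in> o[at_right 0](\<lambda>t. t)"


text \<open>Exact sums of powers, used to show that little-oh polynomials form a ring.\<close>

inductive power_sum :: "(real \<Rightarrow> real) \<Rightarrow> bool" where
  monomial: "\<alpha> \<ge> 0 \<Longrightarrow> power_sum (\<lambda>t. c * t powr \<alpha>)"
| add: "power_sum p \<Longrightarrow> power_sum q \<Longrightarrow> power_sum (\<lambda>t. p t + q t)"

lemma fermat_equiv_refl: "fermat_equiv x x"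
  by (simp add: fermat_equiv_def)

lemma fermat_equiv_sym: "fermat_equiv x y \<Longrightarrow> fermat_equiv y x"
  unfolding fermat_equiv_def
  by (subst landau_o.small.uminus_in_iff [symmetric]) simp

lemma fermat_equiv_trans: "fermat_equiv x y \<Longrightarrow> fermat_equiv y z \<Longrightarrow> fermat_equiv x z"
  unfolding fermat_equiv_def by (drule (1) sum_in_smallo(1)) simp

lemma fermat_equiv_add:
  "fermat_equiv x x' \<Longrightarrow> fermat_equiv y y' \<Longrightarrow> fermat_equiv (\<lambda>t. x t + y t) (\<lambda>t. x' t + y' t)"
  unfolding fermat_equiv_def by (drule (1) sum_in_smallo(1)) (simp add: algebra_simps)

lemma fermat_equiv_cong:
  assumes "\<And>t. t > 0 \<Longrightarrow> x t = y t"
  shows "fermat_equiv x y"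
proof -
  have "\<forall>\<^sub>F t in at_right 0. x t - y t = 0"
    using assms eventually_at_right_less[of "0::real"] by (auto elim!: eventually_mono)
  then show ?thesis
    unfolding fermat_equiv_def by (subst landau_o.small.in_cong[where g = "\<lambda>_. 0"]) auto
qed

lemma power_sum_finite_sum:
  assumes "finite I" "\<And>i. i \<in> I \<Longrightarrow> \<alpha> i \<ge> 0"
  shows "power_sum (\<lambda>t. \<Sum>i\<in>I. a i * t powr \<alpha> i)"
  using assms
proof (induction I rule: finite_induct)
  case empty
  show ?case using power_sum.monomial[of 0 0] by simp
next
  case (insert i I)
  then show ?case using power_sum.add[OF power_sum.monomial[of "\<alpha> i" "a i"]] by simp
qed

lemma power_sum_normal_form:
  assumes "power_sum p"
  shows "\<exists>A c. finite A \<and> (\<forall>\<alpha>\<in>A. \<alpha> \<ge> 0) \<and> p = (\<lambda>t. \<Sum>\<alpha>\<in>A. c \<alpha> * t powr \<alpha>)"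
  using assms
proof induction
  case (monomial \<alpha> c)
  then show ?case by (intro exI[of _ "{\<alpha>}"] exI[of _ "\<lambda>_. c"]) auto
next
  case (add p q)
  then obtain A c B d where *: "finite A" "\<forall>\<alpha>\<in>A. \<alpha> \<ge> 0" "p = (\<lambda>t. \<Sum>\<alpha>\<in>A. c \<alpha> * t powr \<alpha>)"
     "finite B" "\<forall>\<alpha>\<in>B. \<alpha> \<ge> 0" "q = (\<lambda>t. \<Sum>\<alpha>\<in>B. d \<alpha> * t powr \<alpha>)" by auto
  define e where "e \<alpha> = (if \<alpha> \<in> A then c \<alpha> else 0) + (if \<alpha> \<in> B then d \<alpha> else 0)" for \<alpha>
  have "p t + q t = (\<Sum>\<alpha>\<in>A\<union>B. e \<alpha> * t powr \<alpha>)" for t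
  proof -
    have "p t = (\<Sum>\<alpha>\<in>A\<union>B. (if \<alpha> \<in> A then c \<alpha> else 0) * t powr \<alpha>)"
      unfolding * using * by (intro sum.mono_neutral_cong_left) auto
    moreover have "q t = (\<Sum>\<alpha>\<in>A\<union>B. (if \<alpha> \<in> B then d \<alpha> else 0) * t powr \<alpha>)"
      unfolding * using * by (intro sum.mono_neutral_cong_left) auto
    ultimately show ?thesis
      by (simp add: e_def sum.distrib algebra_simps)
  qed
  with * show ?case by (intro exI[of _ "A \<union> B"] exI[of _ e]) auto
qed

lemma power_sum_mult_term:
  assumes "power_sum q" "\<alpha> \<ge> 0"
  shows "power_sum (\<lambda>t. (c * t powr \<alpha>) * q t)"
  using assms(1)
proof induction
  case (monomial \<beta> d)
  have "(\<lambda>t. (c * t powr \<alpha>) * (d * t powr \<beta>)) = (\<lambda>t. (c * d) * t powr (\<alpha> + \<beta>))"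
    by (auto simp: powr_add)
  then show ?case using power_sum.monomial[of "\<alpha> + \<beta>" "c * d"] monomial assms(2) by simp
next
  case (add p q)
  then show ?case using power_sum.add by (fastforce simp: distrib_left)
qed

lemma power_sum_mult:
  assumes "power_sum p" "power_sum q"
  shows "power_sum (\<lambda>t. p t * q t)"
  using assms(1)
proof induction
  case (monomial \<alpha> c)
  then show ?case using power_sum_mult_term assms(2) by blast
next
  case (add p1 p2)
  then show ?case using power_sum.add by (fastforce simp: distrib_right)
qed

lemma little_oh_poly_iff: "little_oh_poly x \<longleftrightarrow> (\<exists>p. power_sum p \<and> fermat_equiv x p)"
proof
  assume "little_oh_poly x"
  then obtain N r a \<alpha> where *: "\<forall>i\<in>{1..N::nat}. \<alpha> i \<ge> (0::real)"
    "fermat_equiv x (\<lambda>t. r + (\<Sum>i=1..N. a i * t powr \<alpha> i))"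
    unfolding little_oh_poly_def fermat_equiv_def by blast
  define p where "p = (\<lambda>t. r * t powr 0 + (\<Sum>i=1..N. a i * t powr \<alpha> i))"
  have "power_sum p"
    unfolding p_def using * by (intro power_sum.intros power_sum_finite_sum) auto
  moreover have "fermat_equiv x p"
    by (rule fermat_equiv_trans[OF *(2)], rule fermat_equiv_cong) (auto simp: p_def)
  ultimately show "\<exists>p. power_sum p \<and> fermat_equiv x p" by blast
next
  assume "\<exists>p. power_sum p \<and> fermat_equiv x p"
  then obtain A c where *: "finite A" "\<forall>\<alpha>\<in>A. \<alpha> \<ge> (0::real)"
      "fermat_equiv x (\<lambda>t. \<Sum>\<alpha>\<in>A. c \<alpha> * t powr \<alpha>)"
    using power_sum_normal_form by blast
  obtain h where h: "bij_betw h {1..card A} A"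
    using ex_bij_betw_nat_finite_1[OF *(1)] by blast
  have "(\<Sum>\<alpha>\<in>A. c \<alpha> * t powr \<alpha>) = 0 + (\<Sum>i=1..card A. c (h i) * t powr h i)" for t
    using sum.reindex_bij_betw[OF h, of "\<lambda>\<alpha>. c \<alpha> * t powr \<alpha>"] by simp
  then have "(\<lambda>t. x t - (0 + (\<Sum>i=1..card A. c (h i) * t powr h i))) \<in> o[at_right 0](\<lambda>t. t)"
    using *(3) unfolding fermat_equiv_def by simp
  moreover have "\<forall>i\<in>{1..card A}. h i \<ge> 0"
    using h *(2) by (auto simp: bij_betw_def)
  ultimately show "little_oh_poly x"
    unfolding little_oh_poly_def
    by (intro exI[of _ "card A"] exI[of _ 0] exI[of _ "\<lambda>i. c (h i)"] exI[of _ h]) simp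
qed

lemma tendsto_powr_0_right:
  assumes "(\<alpha>::real) > 0"
  shows "((\<lambda>t. t powr \<alpha>) \<longlongrightarrow> 0) (at_right 0)"
proof -
  have "((\<lambda>t::real. t powr \<alpha>) \<longlongrightarrow> 0 powr \<alpha>) (at_right 0)"
    using assms by (intro tendsto_powr2)
      (auto intro!: tendsto_ident_at eventually_at_rightI[of 0 1])
  then show ?thesis using assms by simp
qed

lemma power_sum_convergent:
  assumes "power_sum p"
  shows "\<exists>l. (p \<longlongrightarrow> l) (at_right 0)"
  using assms
proof induction
  case (monomial \<alpha> c)
  show ?case
  proof (cases "\<alpha> = 0")
    case True
    have "\<forall>\<^sub>F t in at_right 0. c = c * t powr \<alpha>"
      using eventually_at_right_less[of "0::real"] by eventually_elim (simp add: True)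
    then have "((\<lambda>t. c * t powr \<alpha>) \<longlongrightarrow> c) (at_right 0)"
      by (rule Lim_transform_eventually[rotated]) simp
    then show ?thesis ..
  next
    case False
    with monomial have "((\<lambda>t. c * t powr \<alpha>) \<longlongrightarrow> c * 0) (at_right 0)"
      by (intro tendsto_mult tendsto_const tendsto_powr_0_right) auto
    then show ?thesis ..
  qed
next
  case (add p q)
  then show ?case by (blast intro: tendsto_add)
qed

lemma smallo_id_tendsto_0:
  assumes "e \<in> o[at_right (0::real)](\<lambda>t. t)"
  shows "(e \<longlongrightarrow> (0::real)) (at_right 0)"
proof -
  have "((\<lambda>t. e t / t) \<longlongrightarrow> 0) (at_right 0)"
    using assms by (rule smalloD_tendsto)
  then have "((\<lambda>t. e t / t * t) \<longlongrightarrow> 0 * 0) (at_right 0)"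
    by (intro tendsto_mult tendsto_ident_at)
  moreover have "\<forall>\<^sub>F t in at_right 0. e t / t * t = e t"
    using eventually_at_right_less[of "0::real"] by eventually_elim simp
  ultimately show ?thesis by (simp add: tendsto_cong)
qed

lemma fermat_equiv_tendsto:
  assumes "fermat_equiv x y" "(y \<longlongrightarrow> l) (at_right 0)"
  shows "(x \<longlongrightarrow> l) (at_right 0)"
  using tendsto_add[OF smallo_id_tendsto_0[OF assms(1)[unfolded fermat_equiv_def]] assms(2)]
  by simp

lemma little_oh_poly_convergent: "little_oh_poly x \<Longrightarrow> \<exists>l. (x \<longlongrightarrow> l) (at_right 0)"
  unfolding little_oh_poly_iff using power_sum_convergent fermat_equiv_tendsto by blast

lemma little_oh_poly_bigo_1:
  assumes "little_oh_poly x"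
  shows "x \<in> O[at_right 0](\<lambda>_. 1)"
proof -
  from little_oh_poly_convergent[OF assms] obtain l where "(x \<longlongrightarrow> l) (at_right 0)" ..
  then show ?thesis by (intro bigoI_tendsto[of _ _ l]) auto
qed

lemma fermat_equiv_mult:
  assumes "fermat_equiv x x'" "fermat_equiv y y'" "little_oh_poly x'" "little_oh_poly y"
  shows "fermat_equiv (\<lambda>t. x t * y t) (\<lambda>t. x' t * y' t)"
proof -
  have "(\<lambda>t. (x t - x' t) * y t) \<in> o[at_right 0](\<lambda>t. t * 1)"
    using assms unfolding fermat_equiv_def
    by (intro landau_o.small_big_mult little_oh_poly_bigo_1)
  moreover have "(\<lambda>t. x' t * (y t - y' t)) \<in> o[at_right 0](\<lambda>t. 1 * t)"
    using assms unfolding fermat_equiv_def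
    by (intro landau_o.big_small_mult little_oh_poly_bigo_1)
  ultimately have "(\<lambda>t. (x t - x' t) * y t + x' t * (y t - y' t)) \<in> o[at_right 0](\<lambda>t. t)"
    by (intro sum_in_smallo(1)) simp_all
  then show ?thesis
    unfolding fermat_equiv_def by (simp add: algebra_simps)
qed

lemma little_oh_poly_power_sum: "power_sum p \<Longrightarrow> little_oh_poly p"
  unfolding little_oh_poly_iff using fermat_equiv_refl by blast

lemma little_oh_poly_equiv: "fermat_equiv x y \<Longrightarrow> little_oh_poly y \<Longrightarrow> little_oh_poly x"
  unfolding little_oh_poly_iff using fermat_equiv_trans by blast

lemma little_oh_poly_powr: "\<alpha> \<ge> 0 \<Longrightarrow> little_oh_poly (\<lambda>t. t powr \<alpha>)"
  using little_oh_poly_power_sum[OF power_sum.monomial[of \<alpha> 1]] by simp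

lemma little_oh_poly_const: "little_oh_poly (\<lambda>t. c)"
  by (rule little_oh_poly_equiv[OF _ little_oh_poly_power_sum[OF power_sum.monomial[of 0 c]]])
     (auto intro: fermat_equiv_cong)

lemma little_oh_poly_add:
  "little_oh_poly x \<Longrightarrow> little_oh_poly y \<Longrightarrow> little_oh_poly (\<lambda>t. x t + y t)"
  unfolding little_oh_poly_iff by (blast intro: fermat_equiv_add power_sum.add)

lemma little_oh_poly_mult:
  assumes "little_oh_poly x" "little_oh_poly y"
  shows "little_oh_poly (\<lambda>t. x t * y t)"
proof -
  from assms obtain p q where
    pq: "power_sum p" "fermat_equiv x p" "power_sum q" "fermat_equiv y q"
    unfolding little_oh_poly_iff by blast
  then have "fermat_equiv (\<lambda>t. x t * y t) (\<lambda>t. p t * q t)"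
    by (intro fermat_equiv_mult little_oh_poly_power_sum assms(2))
  then show ?thesis
    unfolding little_oh_poly_iff using power_sum_mult[OF pq(1,3)] by blast
qed

lemma little_oh_poly_uminus: "little_oh_poly x \<Longrightarrow> little_oh_poly (\<lambda>t. - x t)"
  using little_oh_poly_mult[OF little_oh_poly_const[of "-1"]] by simp

lemma little_oh_poly_diff:
  "little_oh_poly x \<Longrightarrow> little_oh_poly y \<Longrightarrow> little_oh_poly (\<lambda>t. x t - y t)"
  using little_oh_poly_add little_oh_poly_uminus by fastforce

lemma fermat_equiv_uminus: "fermat_equiv x y \<Longrightarrow> fermat_equiv (\<lambda>t. - x t) (\<lambda>t. - y t)"
  by (drule fermat_equiv_sym) (simp add: fermat_equiv_def)

lemma fermat_equiv_diff:
  "fermat_equiv x x' \<Longrightarrow> fermat_equiv y y' \<Longrightarrow> fermat_equiv (\<lambda>t. x t - y t) (\<lambda>t. x' t - y' t)"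
  using fermat_equiv_add[OF _ fermat_equiv_uminus] by fastforce


section \<open>The ring of Fermat reals\<close>

quotient_type fermat_real = "real \<Rightarrow> real" / partial:
  "\<lambda>x y. little_oh_poly x \<and> little_oh_poly y \<and> fermat_equiv x y"
  morphisms rep_fermat abs_fermat
proof (rule part_equivpI)
  show "\<exists>x. little_oh_poly x \<and> little_oh_poly x \<and> fermat_equiv x x"
    using little_oh_poly_const fermat_equiv_refl by blast
  show "symp (\<lambda>x y. little_oh_poly x \<and> little_oh_poly y \<and> fermat_equiv x y)"
    by (auto intro!: sympI fermat_equiv_sym)
  show "transp (\<lambda>x y. little_oh_poly x \<and> little_oh_poly y \<and> fermat_equiv x y)"
    by (auto intro!: transpI intro: fermat_equiv_trans)
qed

instantiation fermat_real :: "{comm_ring_1, real_algebra_1}"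
begin

lift_definition zero_fermat_real :: fermat_real is "\<lambda>t. 0"
  by (simp add: little_oh_poly_const fermat_equiv_refl)

lift_definition one_fermat_real :: fermat_real is "\<lambda>t. 1"
  by (simp add: little_oh_poly_const fermat_equiv_refl)

lift_definition plus_fermat_real :: "fermat_real \<Rightarrow> fermat_real \<Rightarrow> fermat_real"
  is "\<lambda>x y t. x t + y t"
  by (simp add: little_oh_poly_add fermat_equiv_add)

lift_definition minus_fermat_real :: "fermat_real \<Rightarrow> fermat_real \<Rightarrow> fermat_real"
  is "\<lambda>x y t. x t - y t"
  by (simp add: little_oh_poly_diff fermat_equiv_diff)

lift_definition uminus_fermat_real :: "fermat_real \<Rightarrow> fermat_real"
  is "\<lambda>x t. - x t"
  by (simp add: little_oh_poly_uminus fermat_equiv_uminus)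

lift_definition times_fermat_real :: "fermat_real \<Rightarrow> fermat_real \<Rightarrow> fermat_real"
  is "\<lambda>x y t. x t * y t"
  by (simp add: little_oh_poly_mult fermat_equiv_mult)

lift_definition scaleR_fermat_real :: "real \<Rightarrow> fermat_real \<Rightarrow> fermat_real"
  is "\<lambda>c x t. c * x t"
  by (simp add: little_oh_poly_mult little_oh_poly_const fermat_equiv_mult fermat_equiv_refl)

instance
proof
  show "(0::fermat_real) \<noteq> 1"
  proof (transfer, safe)
    assume "fermat_equiv (\<lambda>t. 0) (\<lambda>t. 1)"
    then have "((\<lambda>t. 0::real) \<longlongrightarrow> 1) (at_right (0::real))"
      by (rule fermat_equiv_tendsto) simp
    then show False
      by (simp add: tendsto_const_iff)
  qed
qed (transfer; simp add: algebra_simps fermat_equiv_refl little_oh_poly_add little_oh_poly_mult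
      little_oh_poly_const little_oh_poly_uminus little_oh_poly_diff)+

end

text \<open>
  By the following lemma, \<^const>\<open>of_real\<close> is the embedding of the reals as classes of constants.
\<close>

lemma of_real_fermat: "of_real r = abs_fermat (\<lambda>t. r)"
  unfolding of_real_def
  by (simp add: scaleR_fermat_real.abs_eq one_fermat_real_def little_oh_poly_const fermat_equiv_refl)

text \<open>Meaningful only for \<open>a > 0\<close>.\<close>

definition dt :: "real \<Rightarrow> fermat_real" where
  "dt a = abs_fermat (\<lambda>t. t powr (1 / a))"


section \<open>Decomposition and standard part\<close>

definition is_decomposition ::
  "fermat_real \<Rightarrow> real \<Rightarrow> nat \<Rightarrow> (nat \<Rightarrow> real) \<Rightarrow> (nat \<Rightarrow> real) \<Rightarrow> bool" where
  "is_decomposition x r N \<alpha> a \<longleftrightarrow>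
     x = of_real r + (\<Sum>i=1..N. of_real (\<alpha> i) * dt (a i)) \<and>
     (\<forall>i\<in>{1..N}. \<alpha> i \<noteq> 0 \<and> a i \<ge> 1) \<and>
     (\<forall>i\<in>{1..N}. \<forall>j\<in>{1..N}. i < j \<longrightarrow> a i > a j)"

definition standard_part :: "fermat_real \<Rightarrow> real" where
  "standard_part x = (THE r. \<exists>N \<alpha> a. is_decomposition x r N \<alpha> a)"

lemma abs_fermat_eq_iff:
  "little_oh_poly x \<Longrightarrow> little_oh_poly y \<Longrightarrow> abs_fermat x = abs_fermat y \<longleftrightarrow> fermat_equiv x y"
  using Quotient3_rel[OF Quotient3_fermat_real, of x y] by (auto simp: fermat_equiv_refl)

lemma abs_fermat_cases:
  obtains x where "X = abs_fermat x" "little_oh_poly x"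
  by (metis (no_types, lifting) Quotient3_abs_rep Quotient3_fermat_real Quotient3_rep_reflp)

lemma abs_fermat_sum_powr:
  assumes "\<And>i. i \<in> I \<Longrightarrow> (a::'i \<Rightarrow> real) i > 0"
  shows "little_oh_poly (\<lambda>t. \<Sum>i\<in>I. c i * t powr (1 / a i)) \<and>
    (\<Sum>i\<in>I. of_real (c i) * dt (a i)) = abs_fermat (\<lambda>t. \<Sum>i\<in>I. c i * t powr (1 / a i))"
  using assms
proof (induction I rule: infinite_finite_induct)
  case (insert i I)
  have 1: "little_oh_poly (\<lambda>t. t powr (1 / a i))"
    using insert.prems[of i] by (intro little_oh_poly_powr) auto
  have 2: "little_oh_poly (\<lambda>t. c i * t powr (1 / a i))"
    using 1 by (intro little_oh_poly_mult little_oh_poly_const)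
  have "of_real (c i) * dt (a i) = abs_fermat (\<lambda>t. c i * t powr (1 / a i))"
    unfolding of_real_fermat dt_def using 1
    by (simp add: times_fermat_real.abs_eq little_oh_poly_const fermat_equiv_refl)
  then show ?case
    using insert 2
    by (simp add: plus_fermat_real.abs_eq fermat_equiv_refl little_oh_poly_add)
qed (auto simp: zero_fermat_real_def little_oh_poly_const)

lemma abs_fermat_decomposition:
  assumes "\<forall>i\<in>I. (a::'i \<Rightarrow> real) i > 0"
  shows "little_oh_poly (\<lambda>t. r + (\<Sum>i\<in>I. c i * t powr (1 / a i))) \<and>
    of_real r + (\<Sum>i\<in>I. of_real (c i) * dt (a i)) =
      abs_fermat (\<lambda>t. r + (\<Sum>i\<in>I. c i * t powr (1 / a i)))"
  using abs_fermat_sum_powr[of I a c] assms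
  by (simp add: of_real_fermat plus_fermat_real.abs_eq fermat_equiv_refl little_oh_poly_add
      little_oh_poly_const)

lemma is_decomposition_imp_tendsto:
  assumes "is_decomposition (abs_fermat x) r N \<alpha> a" "little_oh_poly x"
  shows "(x \<longlongrightarrow> r) (at_right 0)"
proof -
  have a: "\<forall>i\<in>{1..N}. a i > 0"
    using assms(1) unfolding is_decomposition_def by (meson less_le_trans zero_less_one)
  have "fermat_equiv x (\<lambda>t. r + (\<Sum>i=1..N. \<alpha> i * t powr (1 / a i)))"
    using assms abs_fermat_decomposition[OF a, of r \<alpha>]
    unfolding is_decomposition_def by (simp add: abs_fermat_eq_iff)
  moreover have "((\<lambda>t. r + (\<Sum>i=1..N. \<alpha> i * t powr (1 / a i))) \<longlongrightarrow> r + (\<Sum>i=1..N. \<alpha> i * 0))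
      (at_right 0)"
    using a by (intro tendsto_intros tendsto_powr_0_right) auto
  ultimately show ?thesis
    using fermat_equiv_tendsto by fastforce
qed

lemma fermat_equiv_power_sum_drop:
  assumes "finite A" "\<forall>\<alpha>\<in>A. \<alpha> > (1::real)"
  shows "fermat_equiv (\<lambda>t. \<Sum>\<alpha>\<in>A. c \<alpha> * t powr \<alpha>) (\<lambda>t. 0)"
proof -
  have "(\<lambda>t. c \<alpha> * t powr \<alpha>) \<in> o[at_right 0](\<lambda>t. t)" if "\<alpha> \<in> A" for \<alpha>
  proof (rule smalloI_tendsto)
    have "((\<lambda>t. c \<alpha> * t powr (\<alpha> - 1)) \<longlongrightarrow> c \<alpha> * 0) (at_right 0)"
      using that assms by (intro tendsto_mult tendsto_const tendsto_powr_0_right) auto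
    moreover have "\<forall>\<^sub>F t in at_right 0. c \<alpha> * t powr (\<alpha> - 1) = c \<alpha> * t powr \<alpha> / t"
      using eventually_at_right_less[of "0::real"]
      by eventually_elim (simp add: powr_diff)
    ultimately show "((\<lambda>t. c \<alpha> * t powr \<alpha> / t) \<longlongrightarrow> 0) (at_right 0)"
      by (simp add: tendsto_cong)
    show "\<forall>\<^sub>F t in at_right 0. t \<noteq> (0::real)"
      using eventually_at_right_less[of "0::real"] by eventually_elim simp
  qed
  then show ?thesis
    unfolding fermat_equiv_def by (simp add: big_sum_in_smallo)
qed

lemma is_decomposition_exists: "\<exists>r N \<alpha> a. is_decomposition X r N \<alpha> a"
proof -
  obtain x where x: "X = abs_fermat x" "little_oh_poly x"
    by (rule abs_fermat_cases)
  then obtain A c where A: "finite A" "\<forall>\<alpha>\<in>A. \<alpha> \<ge> (0::real)"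
      "fermat_equiv x (\<lambda>t. \<Sum>\<alpha>\<in>A. c \<alpha> * t powr \<alpha>)"
    unfolding little_oh_poly_iff using power_sum_normal_form by blast
  define B where "B = {\<alpha>\<in>A. 0 < \<alpha> \<and> \<alpha> \<le> 1 \<and> c \<alpha> \<noteq> 0}"
  define C where "C = {\<alpha>\<in>A. \<alpha> > 1}"
  define r where "r = (if 0 \<in> A then c 0 else 0)"
  have B: "finite B" and C: "finite C" using A(1) by (auto simp: B_def C_def)
  have "(\<Sum>\<alpha>\<in>A. c \<alpha> * t powr \<alpha>) = r + (\<Sum>\<alpha>\<in>B. c \<alpha> * t powr \<alpha>) + (\<Sum>\<alpha>\<in>C. c \<alpha> * t powr \<alpha>)"
    if "t > 0" for t
  proof -
    have "(\<Sum>\<alpha>\<in>A. c \<alpha> * t powr \<alpha>) = (\<Sum>\<alpha>\<in>(A \<inter> {0}) \<union> (B \<union> C). c \<alpha> * t powr \<alpha>)"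
      using A by (intro sum.mono_neutral_right) (force simp: B_def C_def)+
    also have "\<dots> = (\<Sum>\<alpha>\<in>A \<inter> {0}. c \<alpha> * t powr \<alpha>) +
        ((\<Sum>\<alpha>\<in>B. c \<alpha> * t powr \<alpha>) + (\<Sum>\<alpha>\<in>C. c \<alpha> * t powr \<alpha>))"
      using B C by (subst sum.union_disjoint; (subst sum.union_disjoint)?) (auto simp: B_def C_def)
    also have "(\<Sum>\<alpha>\<in>A \<inter> {0}. c \<alpha> * t powr \<alpha>) = r"
      using that by (auto simp: r_def)
    finally show ?thesis by simp
  qed
  then have "fermat_equiv (\<lambda>t. \<Sum>\<alpha>\<in>A. c \<alpha> * t powr \<alpha>)
      (\<lambda>t. r + (\<Sum>\<alpha>\<in>B. c \<alpha> * t powr \<alpha>) + (\<Sum>\<alpha>\<in>C. c \<alpha> * t powr \<alpha>))"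
    by (rule fermat_equiv_cong)
  moreover have "fermat_equiv (\<lambda>t. r + (\<Sum>\<alpha>\<in>B. c \<alpha> * t powr \<alpha>) + (\<Sum>\<alpha>\<in>C. c \<alpha> * t powr \<alpha>))
      (\<lambda>t. r + (\<Sum>\<alpha>\<in>B. c \<alpha> * t powr \<alpha>) + 0)"
    using C by (intro fermat_equiv_add fermat_equiv_refl fermat_equiv_power_sum_drop)
      (auto simp: C_def)
  ultimately have eq: "fermat_equiv x (\<lambda>t. r + (\<Sum>\<alpha>\<in>B. c \<alpha> * t powr \<alpha>))"
    using fermat_equiv_trans[OF fermat_equiv_trans[OF A(3)]] by simp
  define h where "h i = sorted_list_of_set B ! (i - 1)" for i
  have len: "length (sorted_list_of_set B) = card B" by simp
  have hB: "h i \<in> B" if "i \<in> {1..card B}" for i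
    using that B len nth_mem[of "i - 1" "sorted_list_of_set B"] by (auto simp: h_def)
  have hmono: "h i < h j" if "i \<in> {1..card B}" "j \<in> {1..card B}" "i < j" for i j
    using sorted_wrt_nth_less[OF strict_sorted_list_of_set, of "i - 1" "j - 1" B] that len
    by (auto simp: h_def)
  have "inj_on h {1..card B}"
    by (rule inj_onI) (metis hmono less_irrefl linorder_neqE_nat)
  moreover from this have "h ` {1..card B} = B"
    using hB B by (intro card_subset_eq) (auto simp: card_image)
  ultimately have bij: "bij_betw h {1..card B} B"
    by (simp add: bij_betw_def)
  define a where "a i = 1 / h i" for i
  have apos: "\<forall>i\<in>{1..card B}. a i > 0"
    using hB by (auto simp: a_def B_def)
  have sum: "(\<Sum>\<alpha>\<in>B. c \<alpha> * t powr \<alpha>) = (\<Sum>i=1..card B. c (h i) * t powr (1 / a i))" for t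
    using sum.reindex_bij_betw[OF bij, of "\<lambda>\<alpha>. c \<alpha> * t powr \<alpha>"] by (simp add: a_def)
  have "is_decomposition X r (card B) (\<lambda>i. c (h i)) a"
    unfolding is_decomposition_def
  proof (intro conjI ballI impI)
    show "X = of_real r + (\<Sum>i=1..card B. of_real (c (h i)) * dt (a i))"
      using abs_fermat_decomposition[OF apos, of r "\<lambda>i. c (h i)"] eq x
      unfolding sum by (simp add: abs_fermat_eq_iff)
    show "c (h i) \<noteq> 0" "a i \<ge> 1" if "i \<in> {1..card B}" for i
      using hB[OF that] by (auto simp: B_def a_def)
    show "a i > a j" if "i \<in> {1..card B}" "j \<in> {1..card B}" "i < j" for i j
      using hmono[OF that] hB[OF that(1)] by (auto simp: B_def a_def intro: divide_strict_left_mono)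
  qed
  then show ?thesis by blast
qed

lemma standard_part_unique:
  assumes "is_decomposition X r N \<alpha> a" "is_decomposition X r' N' \<alpha>' a'"
  shows "r = r'"
proof -
  obtain x where x: "X = abs_fermat x" "little_oh_poly x"
    by (rule abs_fermat_cases)
  show ?thesis
    using assms x is_decomposition_imp_tendsto tendsto_unique trivial_limit_at_right_real by metis
qed

lemma standard_part_eqI: "is_decomposition X r N \<alpha> a \<Longrightarrow> standard_part X = r"
  unfolding standard_part_def using standard_part_unique by blast

lemma standard_part_tendsto:
  "little_oh_poly x \<Longrightarrow> (x \<longlongrightarrow> standard_part (abs_fermat x)) (at_right 0)"
  using is_decomposition_exists is_decomposition_imp_tendsto standard_part_eqI by metis

lemma standard_part_of_real [simp]: "standard_part (of_real r) = r"
  by (rule standard_part_eqI[of _ _ 0]) (simp add: is_decomposition_def)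


section \<open>Pseudometrics\<close>

text \<open>
  The library's metric notions require \<open>d x y = 0\<close> to imply \<open>x = y\<close>, so the basic notions are
  stated here for an arbitrary distance function on a type.
\<close>

definition pseudometric :: "('a \<Rightarrow> 'a \<Rightarrow> real) \<Rightarrow> bool" where
  "pseudometric d \<longleftrightarrow>
     (\<forall>x y. d x y \<ge> 0) \<and> (\<forall>x. d x x = 0) \<and> (\<forall>x y. d x y = d y x) \<and>
     (\<forall>x y z. d x z \<le> d x y + d y z)"

definition Cauchy_wrt :: "('a \<Rightarrow> 'a \<Rightarrow> real) \<Rightarrow> (nat \<Rightarrow> 'a) \<Rightarrow> bool" where
  "Cauchy_wrt d s \<longleftrightarrow> (\<forall>\<epsilon>>0. \<exists>M. \<forall>m\<ge>M. \<forall>n\<ge>M. d (s m) (s n) < \<epsilon>)"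

definition converges_wrt :: "('a \<Rightarrow> 'a \<Rightarrow> real) \<Rightarrow> (nat \<Rightarrow> 'a) \<Rightarrow> 'a \<Rightarrow> bool" where
  "converges_wrt d s x \<longleftrightarrow> (\<forall>\<epsilon>>0. \<exists>M. \<forall>n\<ge>M. d (s n) x < \<epsilon>)"

definition complete_wrt :: "('a \<Rightarrow> 'a \<Rightarrow> real) \<Rightarrow> bool" where
  "complete_wrt d \<longleftrightarrow> (\<forall>s. Cauchy_wrt d s \<longrightarrow> (\<exists>x. converges_wrt d s x))"

definition fermat_dist :: "fermat_real \<Rightarrow> fermat_real \<Rightarrow> real" where
  "fermat_dist x y = \<bar>standard_part x - standard_part y\<bar>"

lemma pseudometric_fermat_dist: "pseudometric fermat_dist"
  by (auto simp: pseudometric_def fermat_dist_def)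

definition monad :: "real \<Rightarrow> fermat_real set" where
  "monad r = {x. standard_part x = r}"

end

theory Submission
  imports Defs
begin

text \<open>\<open>fermat_dist\<close> is the usual distance on the reals pulled back along
  \<open>standard_part\<close>, so being Cauchy or converging can be tested on standard parts (the
  two \<open>_iff\<close> lemmas). As \<open>standard_part\<close> is onto, completeness is
  inherited from the reals. Limits see only the standard part, so all points of
  \<open>monad r\<close> are limits at once.\<close>

lemma Cauchy_wrt_fermat_dist_iff:
  "Cauchy_wrt fermat_dist s \<longleftrightarrow> Cauchy (\<lambda>n. standard_part (s n))"
  by (simp add: Cauchy_wrt_def Cauchy_def fermat_dist_def dist_real_def)

lemma converges_wrt_fermat_dist_iff:
  "converges_wrt fermat_dist s x \<longleftrightarrow> (\<lambda>n. standard_part (s n)) \<longlonglongrightarrow> standard_part x"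
  by (simp add: converges_wrt_def lim_sequentially fermat_dist_def dist_real_def)

lemma complete_wrt_fermat_dist: "complete_wrt fermat_dist"
  unfolding complete_wrt_def
proof (intro allI impI)
  fix s
  assume "Cauchy_wrt fermat_dist s"
  then obtain r where "(\<lambda>n. standard_part (s n)) \<longlonglongrightarrow> r"
    unfolding Cauchy_wrt_fermat_dist_iff Cauchy_convergent_iff convergent_def by blast
  \<comment> \<open>The embedded real is a convenient preimage of \<open>r\<close> under
    \<open>standard_part\<close>; any member of \<open>monad r\<close> would do.\<close>
  then have "converges_wrt fermat_dist s (of_real r)"
    by (simp add: converges_wrt_fermat_dist_iff)
  then show "\<exists>x. converges_wrt fermat_dist s x" ..
qed

theorem theorem7:
  shows "complete_wrt fermat_dist \<and>
    (\<forall>s :: nat \<Rightarrow> fermat_real. Cauchy_wrt fermat_dist s \<longrightarrow>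
       Cauchy (\<lambda>n. standard_part (s n)) \<and>
       (\<forall>r. (\<lambda>n. standard_part (s n)) \<longlonglongrightarrow> r \<longrightarrow>
          (\<forall>x \<in> monad r. converges_wrt fermat_dist s x)))"
  by (simp add: complete_wrt_fermat_dist Cauchy_wrt_fermat_dist_iff converges_wrt_fermat_dist_iff
      monad_def)

end
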